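(* Every $\text{PCTL}_{\mathit{live}}^{<}$-formula is a liveness property.
   Context: Fix a finite non-empty set $\mathit{AP}$. A probabilistic tree (PT) is $T=(W,L,P)$ with $\epsilon\notin W$, $W\cup\{\epsilon\}\subseteq\mathbb{N}^*$ prefix-closed, $L:W\to\mathcal{P}(\mathit{AP})$, and $P$ a partial function from $W$ to distributions over $W$ with $P(\pi)(\pi')>0$ iff $\pi'=\pi\cdot n\in W$ for some $n$. $T$ is total if every node is a proper prefix of some node; finite-depth if node lengths are bounded. $\mathbb{T}^\omega$, $\mathbb{T}^*$: sets of total, finite-depth PTs. For $T_1\in\mathbb{T}^*$, $T_1\preceq T_2$ iff $W_1\subseteq W_2$, $L_2|_{W_1}=L_1$ and $P_2|_{W_1\times W_1}=P_1$. A property $P\subseteq\mathbb{T}^\omega$ is a liveness property iff every $T_1\in\mathbb{T}^*$ has some $T_2\in P$ with $T_1\preceq T_2$. A Markov chain (MC) is $\mathsf{D}=(S,\mathit{AP},\to,L,s_0)$ with $S\subseteq\mathbb{N}$ countable, $\to:S\to\mathit{Dist}(S)$ total, $L:S\to\mathcal{P}(\mathit{AP})$, initial state $s_0$. Its unfolding $T(\mathsf{D})$ has as nodes the least set of state sequences containing $s_0$ and closed under appending a state $t$ with $\mu(t)>0$ where $\mathrm{last}(\pi)\to\mu$; labels $L(\mathrm{last}(\pi))$; edge probabilities $P(\pi,\pi')=\mu(\mathrm{last}(\pi'))$ with $\mathrm{last}(\pi)\to\mu$. PCTL: state formulas $\Phi::=a\mid\Phi_1\land\Phi_2\mid\neg\Phi\mid\mathbb{P}_{\bowtie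 q}(\varphi)$, path formulas $\varphi::=\mathsf{X}\Phi\mid\Phi_1\mathsf{U}\Phi_2\mid\Phi_1\mathsf{W}\Phi_2$, $\bowtie\in\{<,>,\le,\ge\}$, $q\in[0,1]$, standard semantics on MCs ($\pi\models\Phi_1\mathsf{W}\Phi_2$ iff $\pi\models\Phi_1\mathsf{U}\Phi_2$ or all states of $\pi$ satisfy $\Phi_1$); formulas in positive normal form; $\top=a\lor\neg a$, $\bot=\neg\top$, $\Diamond\Phi=\top\mathsf{U}\Phi$. $P_\Phi=\{T(\mathsf{D})\mid\mathsf{D}\models\Phi\}$ ($\mathsf{D}\models\Phi$ iff the initial state satisfies $\Phi$); $\Phi$ is a liveness property iff $P_\Phi$ is; $\Phi\equiv\Psi$ iff $P_\Phi=P_\Psi$. Literal formulas: $\Phi^a::=a\mid\neg\Phi^a\mid\Phi^a_1\land\Phi^a_2$. $\text{PCTL}_{\mathit{live}}^{<}$ is the smallest set $\mathcal{F}$ of PCTL formulas such that: (1) $\top\in\mathcal{F}$ and $\bot\notin\mathcal{F}$ (no formula equivalent to $\bot$ belongs to $\mathcal{F}$); (2) $\mathbb{P}_{\ge q}(\Diamond\Phi^a)\in\mathcal{F}$ for every literal formula $\Phi^a$; (3) if $\Phi_1,\Phi_2\in\mathcal{F}$ then $\Phi_1\land\Phi_2\in\mathcal{F}$; (4) if $\Phi_1\in\mathcal{F}$ or $\Phi_2\in\mathcal{F}$ then $\Phi_1\lor\Phi_2$, $\mathbb{P}_{\ge q}(\Phi_1\mathsf{W}\Phi_2)\in\mathcal{F}$;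 (5) if $\Phi\in\mathcal{F}$ then $\mathbb{P}_{\ge q}(\mathsf{X}\Phi)\in\mathcal{F}$; (6) if $\Phi_2\in\mathcal{F}$ then $\mathbb{P}_{\ge q}(\Phi_1\mathsf{U}\Phi_2)\in\mathcal{F}$ for any $\Phi_1$.
   Formalization: P_Φ is taken up to isomorphism of PTs and a PT has at most one node of length 1 (otherwise no P_Φ is live); "no formula equivalent to ⊥ in F" is read as a side condition on every rule, since rule (2) yields P≥1(◇(a∧¬a)). *)

theory Defs
  imports "HOL-Probability.Probability" "HOL-Library.Sublist"
begin

section \<open>Probabilistic trees\<close>

text \<open>
  The finite non-empty set of atomic propositions is the type variable \<open>'ap\<close> (of class
  \<open>finite\<close> in the theorem). A partial map \<open>W \<rightharpoonup> Dist(W)\<close> is an option-valued function.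
\<close>

record 'ap pt =
  nodes :: "nat list set"
  lab :: "nat list \<Rightarrow> 'ap set"
  sdist :: "nat list \<Rightarrow> nat list pmf option"

definition edge_prob :: "'ap pt \<Rightarrow> nat list \<Rightarrow> nat list \<Rightarrow> real" where
  "edge_prob T \<pi> \<pi>' = (case sdist T \<pi> of None \<Rightarrow> 0 | Some \<mu> \<Rightarrow> pmf \<mu> \<pi>')"

text \<open>
  The third conjunct says that a tree has at most one root: as \<open>[]\<close> is not a node, the
  nodes of length one are the roots. It is needed since unfoldings of Markov chains have a single
  root and hence cannot extend a forest.
  The last conjunct forces \<open>sdist\<close> to be undefined exactly at the leaves.
\<close>

definition is_pt :: "'ap pt \<Rightarrow> bool" where
  "is_pt T \<longleftrightarrow>
     [] \<notin> nodes T \<and>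
     (\<forall>\<pi>\<in>nodes T. \<forall>\<pi>'. prefix \<pi>' \<pi> \<longrightarrow> \<pi>' \<in> nodes T \<union> {[]}) \<and>
     (\<forall>m n. [m] \<in> nodes T \<longrightarrow> [n] \<in> nodes T \<longrightarrow> m = n) \<and>
     (\<forall>\<pi>. \<pi> \<notin> nodes T \<longrightarrow> sdist T \<pi> = None) \<and>
     (\<forall>\<pi>\<in>nodes T. \<forall>\<mu>. sdist T \<pi> = Some \<mu> \<longrightarrow> set_pmf \<mu> \<subseteq> nodes T) \<and>
     (\<forall>\<pi>\<in>nodes T. \<forall>\<pi>'. edge_prob T \<pi> \<pi>' > 0 \<longleftrightarrow> (\<exists>n. \<pi>' = \<pi> @ [n]) \<and> \<pi>' \<in> nodes T)"

definition total_pts :: "'ap pt set" where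
  "total_pts = {T. is_pt T \<and> (\<forall>\<pi>\<in>nodes T. \<exists>\<pi>'\<in>nodes T. strict_prefix \<pi> \<pi>')}"

definition finite_depth_pts :: "'ap pt set" where
  "finite_depth_pts = {T. is_pt T \<and> (\<exists>k. \<forall>\<pi>\<in>nodes T. length \<pi> \<le> k)}"

text \<open>
  The transition probabilities are compared as functions on \<open>nodes T\<^sub>1 \<times> nodes T\<^sub>1\<close>, undefined
  counting as 0: a leaf of \<open>T\<^sub>1\<close> may have successors in \<open>T\<^sub>2\<close>.
\<close>

definition pt_prefix :: "'ap pt \<Rightarrow> 'ap pt \<Rightarrow> bool" where
  "pt_prefix T\<^sub>1 T\<^sub>2 \<longleftrightarrow>
     nodes T\<^sub>1 \<subseteq> nodes T\<^sub>2 \<and>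
     (\<forall>\<pi>\<in>nodes T\<^sub>1. lab T\<^sub>2 \<pi> = lab T\<^sub>1 \<pi>) \<and>
     (\<forall>\<pi>\<in>nodes T\<^sub>1. \<forall>\<pi>'\<in>nodes T\<^sub>1. edge_prob T\<^sub>2 \<pi> \<pi>' = edge_prob T\<^sub>1 \<pi> \<pi>')"

definition liveness :: "'ap pt set \<Rightarrow> bool" where
  "liveness P \<longleftrightarrow> P \<subseteq> total_pts \<and> (\<forall>T\<^sub>1\<in>finite_depth_pts. \<exists>T\<^sub>2\<in>P. pt_prefix T\<^sub>1 T\<^sub>2)"

definition pt_iso :: "'ap pt \<Rightarrow> 'ap pt \<Rightarrow> bool" where
  "pt_iso T\<^sub>1 T\<^sub>2 \<longleftrightarrow> (\<exists>f. bij_betw f (nodes T\<^sub>1) (nodes T\<^sub>2) \<and>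
     (\<forall>\<pi>\<in>nodes T\<^sub>1. \<forall>\<pi>'\<in>nodes T\<^sub>1. prefix (f \<pi>) (f \<pi>') \<longleftrightarrow> prefix \<pi> \<pi>') \<and>
     (\<forall>\<pi>\<in>nodes T\<^sub>1. lab T\<^sub>2 (f \<pi>) = lab T\<^sub>1 \<pi>) \<and>
     (\<forall>\<pi>\<in>nodes T\<^sub>1. \<forall>\<pi>'\<in>nodes T\<^sub>1. edge_prob T\<^sub>2 (f \<pi>) (f \<pi>') = edge_prob T\<^sub>1 \<pi> \<pi>'))"


section \<open>Markov chains\<close>

record 'ap mc =
  states :: "nat set"
  trn :: "nat \<Rightarrow> nat pmf"
  slab :: "nat \<Rightarrow> 'ap set"
  init :: nat

definition is_mc :: "'ap mc \<Rightarrow> bool" where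
  "is_mc D \<longleftrightarrow> init D \<in> states D \<and> (\<forall>s\<in>states D. set_pmf (trn D s) \<subseteq> states D)"

inductive_set unfolding_nodes :: "'ap mc \<Rightarrow> nat list set" for D :: "'ap mc" where
  root: "[init D] \<in> unfolding_nodes D"
| step: "\<pi> \<in> unfolding_nodes D \<Longrightarrow> pmf (trn D (last \<pi>)) t > 0 \<Longrightarrow> \<pi> @ [t] \<in> unfolding_nodes D"

definition unfolding_pt :: "'ap mc \<Rightarrow> 'ap pt" where
  "unfolding_pt D = \<lparr>nodes = unfolding_nodes D, lab = (\<lambda>\<pi>. slab D (last \<pi>)),
     sdist = (\<lambda>\<pi>. if \<pi> \<in> unfolding_nodes D
       then Some (map_pmf (\<lambda>t. \<pi> @ [t]) (trn D (last \<pi>))) else None)\<rparr>"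

text \<open>
  The probability measure on infinite state sequences starting in \<open>s\<close> is the one given by the
  Ionescu-Tulcea theorem for the kernels ``first \<open>s\<close>, then one step of \<open>D\<close>''; it lives on the
  product \<open>\<sigma>\<close>-algebra, i.e. the one generated by the cylinder sets.
\<close>

definition path_kernel :: "'ap mc \<Rightarrow> nat \<Rightarrow> nat \<Rightarrow> (nat \<Rightarrow> nat) \<Rightarrow> nat measure" where
  "path_kernel D s n \<omega> =
     measure_pmf (case n of 0 \<Rightarrow> return_pmf s | Suc m \<Rightarrow> trn D (\<omega> m))"

lemma Ionescu_Tulcea_path_kernel:
  "Ionescu_Tulcea (path_kernel D s) (\<lambda>_. count_space UNIV)"
proof (rule Ionescu_Tulcea.intro)
  show "path_kernel D s i \<in> measurable (PiM {0..<i} (\<lambda>_. count_space UNIV))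
      (subprob_algebra (count_space UNIV))" for i
  proof (cases i)
    case 0
    then show ?thesis
      by (auto simp: path_kernel_def[abs_def] intro!: measurable_const measure_pmf_in_subprob_algebra)
  next
    case (Suc m)
    have "(\<lambda>\<omega>. \<omega> m) \<in> measurable (PiM {0..<Suc m} (\<lambda>_. count_space UNIV)) (count_space (UNIV::nat set))"
      by (rule measurable_component_singleton) simp
    then have "(\<lambda>\<omega>. measure_pmf (trn D (\<omega> m))) \<in>
        measurable (PiM {0..<Suc m} (\<lambda>_. count_space UNIV)) (subprob_algebra (count_space UNIV))"
      by (rule measurable_compose[where g="\<lambda>s. measure_pmf (trn D s)"])
         (auto intro!: measure_pmf_in_subprob_algebra)
    with Suc show ?thesis
      by (simp add: path_kernel_def[abs_def])
  qed
qed (simp add: path_kernel_def prob_space_measure_pmf)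

definition path_measure :: "'ap mc \<Rightarrow> nat \<Rightarrow> (nat \<Rightarrow> nat) measure" where
  "path_measure D s = projective_family.lim UNIV
     (Ionescu_Tulcea.CI (path_kernel D s) (\<lambda>_. count_space UNIV)) (\<lambda>_. count_space UNIV)"

lemma emeasure_path_measure_cylinder:
  "emeasure (path_measure D s) {\<omega>. \<forall>i\<le>n. \<omega> i = x i} =
     (if x 0 = s then \<Prod>i<n. ennreal (pmf (trn D (x i)) (x (Suc i))) else 0)"
proof -
  interpret IT: Ionescu_Tulcea "path_kernel D s" "\<lambda>_. count_space UNIV"
    by (rule Ionescu_Tulcea_path_kernel)
  let ?M = "\<lambda>_::nat. count_space (UNIV::nat set)"
  let ?C = "\<lambda>n. IT.C 0 n (\<lambda>_. undefined)"
  let ?x = "\<lambda>n. {restrict x {0..<n}}"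
  have x_PiE: "?x n = PiE {0..<n} (\<lambda>i. {x i})" for n
    by (auto simp: PiE_iff extensional_def fun_eq_iff restrict_def)
  have x_sets[measurable]: "?x n \<in> sets (PiM {0..<n} ?M)" for n
    unfolding x_PiE by (rule sets_PiM_I_finite) auto
  have C: "emeasure (?C n) (?x n) = (\<Prod>i<n. emeasure (path_kernel D s i x) {x i})" for n
  proof (induction n)
    case 0
    then show ?case using x_sets[of 0] by (simp add: emeasure_return restrict_def)
  next
    case (Suc n)
    have "emeasure (?C (Suc n)) (?x (Suc n)) = (\<integral>\<^sup>+\<omega>. emeasure (IT.eP n \<omega>) (?x (Suc n)) \<partial>?C n)"
      by (simp, subst emeasure_bind[OF _ _ x_sets])
         (auto simp: IT.space_C space_PiM intro!: measurable_cong_sets[THEN equalityD1, THEN subsetD, OF IT.sets_C[symmetric] refl])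
    also have "\<dots> = (\<integral>\<^sup>+\<omega>. emeasure (path_kernel D s n x) {x n} * indicator (?x n) \<omega> \<partial>?C n)"
    proof (rule nn_integral_cong)
      fix \<omega> assume "\<omega> \<in> space (?C n)"
      then have w: "\<omega> \<in> space (PiM {0..<n} ?M)"
        by (simp add: IT.space_C space_PiM)
      have k: "\<omega> = restrict x {0..<n} \<Longrightarrow> path_kernel D s n \<omega> = path_kernel D s n x"
        by (cases n) (auto simp: path_kernel_def)
      have "fun_upd \<omega> n -` ?x (Suc n) = (if \<omega> = restrict x {0..<n} then {x n} else {})"
        using w by (auto simp: fun_eq_iff restrict_def space_PiM PiE_def extensional_def less_Suc_eq
              split: if_splits) (metis less_irrefl)
      then show "emeasure (IT.eP n \<omega>) (?x (Suc n)) = emeasure (path_kernel D s n x) {x n} * indicator (?x n) \<omega>"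
        using k by (subst IT.emeasure_eP[OF w x_sets]) (auto simp: indicator_def)
    qed
    also have "\<dots> = emeasure (path_kernel D s n x) {x n} * emeasure (?C n) (?x n)"
      using x_sets[of n] by (subst nn_integral_cmult_indicator) (auto simp: IT.sets_C space_PiM)
    also have "\<dots> = (\<Prod>i<Suc n. emeasure (path_kernel D s i x) {x i})"
      unfolding Suc by (simp add: mult.commute)
    finally show ?case .
  qed
  have "{\<omega>. \<forall>i\<le>n. \<omega> i = x i} = IT.PF.emb UNIV {0..<Suc n} (?x (Suc n))"
    by (auto simp: prod_emb_def fun_eq_iff restrict_def space_PiM less_Suc_eq_le split: if_split_asm)
  then have "emeasure (path_measure D s) {\<omega>. \<forall>i\<le>n. \<omega> i = x i} = emeasure (IT.CI {0..<Suc n}) (?x (Suc n))"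
    using IT.lim[OF _ x_sets[of "Suc n"]] by (simp add: path_measure_def)
  also have "\<dots> = emeasure (?C (Suc n)) (?x (Suc n))"
    by (subst IT.emeasure_CI[OF subset_refl x_sets]) (simp add: x_PiE)
  also have "\<dots> = (\<Prod>i<Suc n. emeasure (path_kernel D s i x) {x i})"
    by (rule C)
  also have "\<dots> = emeasure (path_kernel D s 0 x) {x 0} * (\<Prod>i<n. emeasure (path_kernel D s (Suc i) x) {x (Suc i)})"
    by (rule prod.lessThan_Suc_shift)
  also have "\<dots> = (if x 0 = s then \<Prod>i<n. ennreal (pmf (trn D (x i)) (x (Suc i))) else 0)"
    by (simp add: path_kernel_def emeasure_pmf_single)
  finally show ?thesis .
qed


section \<open>PCTL\<close>

datatype cmp = Less | Greater | LessEq | GreaterEq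

primrec cmp_rel :: "cmp \<Rightarrow> real \<Rightarrow> real \<Rightarrow> bool" where
  "cmp_rel Less x y \<longleftrightarrow> x < y"
| "cmp_rel Greater x y \<longleftrightarrow> x > y"
| "cmp_rel LessEq x y \<longleftrightarrow> x \<le> y"
| "cmp_rel GreaterEq x y \<longleftrightarrow> x \<ge> y"

datatype 'ap state_formula =
    Atom 'ap
  | And "'ap state_formula" "'ap state_formula"
  | Neg "'ap state_formula"
  | Prob cmp real "'ap path_formula"
and 'ap path_formula =
    Next "'ap state_formula"
  | Until "'ap state_formula" "'ap state_formula"
  | WeakUntil "'ap state_formula" "'ap state_formula"

text \<open>The PCTL formulas proper are those whose probability bounds all lie in \<open>[0,1]\<close>.\<close>

primrec pctl :: "'ap state_formula \<Rightarrow> bool" and pctl_path :: "'ap path_formula \<Rightarrow> bool" where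
  "pctl (Atom a) \<longleftrightarrow> True"
| "pctl (And \<Phi>\<^sub>1 \<Phi>\<^sub>2) \<longleftrightarrow> pctl \<Phi>\<^sub>1 \<and> pctl \<Phi>\<^sub>2"
| "pctl (Neg \<Phi>) \<longleftrightarrow> pctl \<Phi>"
| "pctl (Prob c q \<phi>) \<longleftrightarrow> 0 \<le> q \<and> q \<le> 1 \<and> pctl_path \<phi>"
| "pctl_path (Next \<Phi>) \<longleftrightarrow> pctl \<Phi>"
| "pctl_path (Until \<Phi>\<^sub>1 \<Phi>\<^sub>2) \<longleftrightarrow> pctl \<Phi>\<^sub>1 \<and> pctl \<Phi>\<^sub>2"
| "pctl_path (WeakUntil \<Phi>\<^sub>1 \<Phi>\<^sub>2) \<longleftrightarrow> pctl \<Phi>\<^sub>1 \<and> pctl \<Phi>\<^sub>2"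

primrec sat :: "'ap mc \<Rightarrow> 'ap state_formula \<Rightarrow> nat \<Rightarrow> bool"
  and path_sat :: "'ap mc \<Rightarrow> 'ap path_formula \<Rightarrow> (nat \<Rightarrow> nat) \<Rightarrow> bool" where
  "sat D (Atom a) s \<longleftrightarrow> a \<in> slab D s"
| "sat D (And \<Phi>\<^sub>1 \<Phi>\<^sub>2) s \<longleftrightarrow> sat D \<Phi>\<^sub>1 s \<and> sat D \<Phi>\<^sub>2 s"
| "sat D (Neg \<Phi>) s \<longleftrightarrow> \<not> sat D \<Phi> s"
| "sat D (Prob c q \<phi>) s \<longleftrightarrow> cmp_rel c (measure (path_measure D s) {\<omega>. path_sat D \<phi> \<omega>}) q"
| "path_sat D (Next \<Phi>) \<omega> \<longleftrightarrow> sat D \<Phi> (\<omega> 1)"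
| "path_sat D (Until \<Phi>\<^sub>1 \<Phi>\<^sub>2) \<omega> \<longleftrightarrow> (\<exists>j. sat D \<Phi>\<^sub>2 (\<omega> j) \<and> (\<forall>i<j. sat D \<Phi>\<^sub>1 (\<omega> i)))"
| "path_sat D (WeakUntil \<Phi>\<^sub>1 \<Phi>\<^sub>2) \<omega> \<longleftrightarrow>
     (\<exists>j. sat D \<Phi>\<^sub>2 (\<omega> j) \<and> (\<forall>i<j. sat D \<Phi>\<^sub>1 (\<omega> i))) \<or> (\<forall>i. sat D \<Phi>\<^sub>1 (\<omega> i))"

definition mc_sat :: "'ap mc \<Rightarrow> 'ap state_formula \<Rightarrow> bool" where
  "mc_sat D \<Phi> \<longleftrightarrow> sat D \<Phi> (init D)"

text \<open>
  Trees are identified up to isomorphism, i.e. up to renaming of nodes. Without this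
  identification no property would be live: a node of an unfolding is a sequence of states
  labelled by the label of its last state, so the finite-depth tree with nodes \<open>[0]\<close> and
  \<open>[0,0]\<close> carrying different labels is not a prefix of any unfolding.
\<close>

definition property_of :: "'ap state_formula \<Rightarrow> 'ap pt set" where
  "property_of \<Phi> = {T. is_pt T \<and> (\<exists>D. is_mc D \<and> mc_sat D \<Phi> \<and> pt_iso T (unfolding_pt D))}"

definition equivalent :: "'ap state_formula \<Rightarrow> 'ap state_formula \<Rightarrow> bool" where
  "equivalent \<Phi> \<Psi> \<longleftrightarrow> property_of \<Phi> = property_of \<Psi>"

definition Or :: "'ap state_formula \<Rightarrow> 'ap state_formula \<Rightarrow> 'ap state_formula" where
  "Or \<Phi>\<^sub>1 \<Phi>\<^sub>2 = Neg (And (Neg \<Phi>\<^sub>1) (Neg \<Phi>\<^sub>2))"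

text \<open>Truth and falsity are written with an atomic proposition \<open>a\<close>, whose choice is immaterial.\<close>

definition Top :: "'ap \<Rightarrow> 'ap state_formula" where
  "Top a = Or (Atom a) (Neg (Atom a))"

definition Bot :: "'ap \<Rightarrow> 'ap state_formula" where
  "Bot a = Neg (Top a)"

definition Eventually :: "'ap \<Rightarrow> 'ap state_formula \<Rightarrow> 'ap path_formula" where
  "Eventually a \<Phi> = Until (Top a) \<Phi>"

definition equiv_Bot :: "'ap state_formula \<Rightarrow> bool" where
  "equiv_Bot \<Phi> \<longleftrightarrow> (\<exists>a. equivalent \<Phi> (Bot a))"

inductive literal :: "'ap state_formula \<Rightarrow> bool" where
  "literal (Atom a)"
| "literal \<Phi> \<Longrightarrow> literal (Neg \<Phi>)"
| "literal \<Phi>\<^sub>1 \<Longrightarrow> literal \<Phi>\<^sub>2 \<Longrightarrow> literal (And \<Phi>\<^sub>1 \<Phi>\<^sub>2)"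

text \<open>
  The requirement that no formula equivalent to \<open>\<bottom>\<close> belongs to the fragment is a side condition
  of every rule. It cannot be imposed on the outcome of the unrestricted rules, since those
  produce for instance \<open>P\<^sub>\<ge>\<^sub>1(\<diamond>(a \<and> \<not>a))\<close>.
\<close>

inductive_set pctl_live :: "'ap state_formula set" where
  top: "Top a \<in> pctl_live"
| eventually:
    "literal \<Psi> \<Longrightarrow> 0 \<le> q \<Longrightarrow> q \<le> 1 \<Longrightarrow>
     \<not> equiv_Bot (Prob GreaterEq q (Eventually a \<Psi>)) \<Longrightarrow>
     Prob GreaterEq q (Eventually a \<Psi>) \<in> pctl_live"
| conj:
    "\<Phi>\<^sub>1 \<in> pctl_live \<Longrightarrow> \<Phi>\<^sub>2 \<in> pctl_live \<Longrightarrow> \<not> equiv_Bot (And \<Phi>\<^sub>1 \<Phi>\<^sub>2) \<Longrightarrow>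
     And \<Phi>\<^sub>1 \<Phi>\<^sub>2 \<in> pctl_live"
| disj:
    "pctl \<Phi>\<^sub>1 \<Longrightarrow> pctl \<Phi>\<^sub>2 \<Longrightarrow> \<Phi>\<^sub>1 \<in> pctl_live \<or> \<Phi>\<^sub>2 \<in> pctl_live \<Longrightarrow>
     \<not> equiv_Bot (Or \<Phi>\<^sub>1 \<Phi>\<^sub>2) \<Longrightarrow>
     Or \<Phi>\<^sub>1 \<Phi>\<^sub>2 \<in> pctl_live"
| weak_until:
    "pctl \<Phi>\<^sub>1 \<Longrightarrow> pctl \<Phi>\<^sub>2 \<Longrightarrow> \<Phi>\<^sub>1 \<in> pctl_live \<or> \<Phi>\<^sub>2 \<in> pctl_live \<Longrightarrow>
     0 \<le> q \<Longrightarrow> q \<le> 1 \<Longrightarrow> \<not> equiv_Bot (Prob GreaterEq q (WeakUntil \<Phi>\<^sub>1 \<Phi>\<^sub>2)) \<Longrightarrow>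
     Prob GreaterEq q (WeakUntil \<Phi>\<^sub>1 \<Phi>\<^sub>2) \<in> pctl_live"
| next_step:
    "\<Phi> \<in> pctl_live \<Longrightarrow> 0 \<le> q \<Longrightarrow> q \<le> 1 \<Longrightarrow>
     \<not> equiv_Bot (Prob GreaterEq q (Next \<Phi>)) \<Longrightarrow>
     Prob GreaterEq q (Next \<Phi>) \<in> pctl_live"
| until:
    "pctl \<Phi>\<^sub>1 \<Longrightarrow> \<Phi>\<^sub>2 \<in> pctl_live \<Longrightarrow> 0 \<le> q \<Longrightarrow> q \<le> 1 \<Longrightarrow>
     \<not> equiv_Bot (Prob GreaterEq q (Until \<Phi>\<^sub>1 \<Phi>\<^sub>2)) \<Longrightarrow>
     Prob GreaterEq q (Until \<Phi>\<^sub>1 \<Phi>\<^sub>2) \<in> pctl_live"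

end

theory Submission
  imports Defs
begin

text \<open>
  Extend a finite-depth tree by infinite non-branching chains below its leaves, whose labels depend
  on the depth only and run through every label infinitely often. In the resulting chain every
  path, from whatever state, visits every label. Hence every state satisfies
  every formula of the fragment: a formula \<open>P\<^sub>\<ge>\<^sub>q(\<diamond>\<Psi>)\<close> not equivalent to \<open>\<bottom>\<close> has \<open>q = 0\<close> or a
  \<open>\<Psi>\<close> that holds at some label, and the other rules preserve validity at all states.
\<close>

section \<open>The path measure\<close>

lemma AE_emeasure_fibre_nonzero:
  fixes f :: "'a \<Rightarrow> 'b::countable"
  assumes "f \<in> measurable M (count_space UNIV)"
  shows "AE x in M. emeasure M (f -` {f x} \<inter> space M) \<noteq> 0"
proof (rule AE_I')
  let ?Y = "{y. emeasure M (f -` {y} \<inter> space M) = 0}"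
  show "(\<Union>y\<in>?Y. f -` {y} \<inter> space M) \<in> null_sets M"
    using measurable_sets[OF assms] by (intro null_sets_UN') auto
qed auto

lemma sets_path_measure: "sets (path_measure D s) = sets (PiM UNIV (\<lambda>_. count_space UNIV))"
proof -
  interpret IT: Ionescu_Tulcea "path_kernel D s" "\<lambda>_. count_space UNIV"
    by (rule Ionescu_Tulcea_path_kernel)
  show ?thesis by (simp add: path_measure_def)
qed

lemma space_path_measure [simp]: "space (path_measure D s) = UNIV"
  using sets_eq_imp_space_eq[OF sets_path_measure[of D s]] by (simp add: space_PiM)

lemma prob_space_path_measure: "prob_space (path_measure D s)"
proof -
  interpret IT: Ionescu_Tulcea "path_kernel D s" "\<lambda>_. count_space UNIV"
    by (rule Ionescu_Tulcea_path_kernel)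
  have "prob_space (distr IT.PF.lim (PiM {} (\<lambda>_. count_space UNIV)) (\<lambda>\<omega>. restrict \<omega> {}))"
    unfolding IT.distr_lim[OF finite.emptyI] by (rule IT.PF.prob_space_P) auto
  then show ?thesis
    unfolding path_measure_def
    by (rule prob_space_distrD[rotated])
      (simp add: measurable_cong_sets[OF IT.PF.sets_lim refl] measurable_restrict_subset)
qed

lemma measurable_path_coordinate:
  "(\<lambda>\<omega>. \<omega> i) \<in> measurable (path_measure D s) (count_space UNIV)"
  by (subst measurable_cong_sets[OF sets_path_measure refl])
    (rule measurable_component_singleton, simp)

lemma pred_path_coordinate: "Measurable.pred (path_measure D s) (\<lambda>\<omega>. P (\<omega> i))"
  by (rule measurable_compose[OF measurable_path_coordinate]) simp

lemma sets_path_sat: "{\<omega>. path_sat D \<phi> \<omega>} \<in> sets (path_measure D s)"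
proof -
  have "Measurable.pred (path_measure D s) (\<lambda>\<omega>. path_sat D \<phi> \<omega>)"
    by (cases \<phi>; simp only: path_sat.simps)
      (intro pred_intros_logic pred_intros_countable pred_intros_imp' pred_path_coordinate)+
  then show ?thesis by (simp add: pred_def)
qed

lemma measurable_path_initial_segment:
  "(\<lambda>\<omega>. map \<omega> [0..<n]) \<in> measurable (path_measure D s) (count_space UNIV)"
proof -
  have "(\<lambda>\<omega>. map \<omega> [0..<n]) -` {xs} \<in> sets (path_measure D s)" for xs
  proof -
    have "Measurable.pred (path_measure D s) (\<lambda>\<omega>. \<forall>i<n. \<omega> i = xs ! i)"
      by (intro pred_intros_countable pred_intros_imp' pred_path_coordinate)
    moreover have "(\<lambda>\<omega>. map \<omega> [0..<n]) -` {xs} =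
        (if length xs = n then {\<omega>. \<forall>i<n. \<omega> i = xs ! i} else {})"
      by (auto simp: vimage_def list_eq_iff_nth_eq)
    ultimately show ?thesis by (simp add: pred_def)
  qed
  then show ?thesis by (simp add: measurable_count_space_eq2_countable)
qed

definition paths :: "'ap mc \<Rightarrow> nat \<Rightarrow> (nat \<Rightarrow> nat) set" where
  "paths D s = {\<omega>. \<omega> 0 = s \<and> (\<forall>i. \<omega> (Suc i) \<in> set_pmf (trn D (\<omega> i)))}"

lemma AE_paths: "AE \<omega> in path_measure D s. \<omega> \<in> paths D s"
proof -
  have "AE \<omega> in path_measure D s. \<omega> 0 = s \<and> (\<forall>i<n. \<omega> (Suc i) \<in> set_pmf (trn D (\<omega> i)))" for n
    using AE_emeasure_fibre_nonzero[OF measurable_path_initial_segment[of "Suc n"]]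
  proof eventually_elim
    case (elim \<omega>)
    have "(\<lambda>\<omega>. map \<omega> [0..<Suc n]) -` {map \<omega> [0..<Suc n]} = {\<omega>'. \<forall>i\<le>n. \<omega>' i = \<omega> i}"
      by (auto simp: vimage_def list_eq_iff_nth_eq less_Suc_eq_le simp del: upt_Suc)
    with elim show ?case
      by (auto simp: emeasure_path_measure_cylinder set_pmf_iff split: if_splits)
  qed
  then have "AE \<omega> in path_measure D s. \<forall>n. \<omega> 0 = s \<and> (\<forall>i<n. \<omega> (Suc i) \<in> set_pmf (trn D (\<omega> i)))"
    by (simp add: AE_all_countable)
  then show ?thesis
    by eventually_elim (auto simp: paths_def)
qed

lemma sat_Prob_GreaterEqI:
  assumes "q \<le> 1" and "\<And>\<omega>. \<omega> \<in> paths D s \<Longrightarrow> path_sat D \<phi> \<omega>"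
  shows "sat D (Prob GreaterEq q \<phi>) s"
proof -
  interpret prob_space "path_measure D s" by (rule prob_space_path_measure)
  have "AE \<omega> in path_measure D s. path_sat D \<phi> \<omega>"
    using AE_paths assms(2) by (rule eventually_mono)
  then have "prob {\<omega>. path_sat D \<phi> \<omega>} = 1"
    by (subst prob_eq_1) (auto simp: sets_path_sat)
  then show ?thesis using assms(1) by simp
qed

section \<open>Label-recurrent chains satisfy the fragment\<close>

lemma sat_Or [simp]: "sat D (Or \<Phi>\<^sub>1 \<Phi>\<^sub>2) s \<longleftrightarrow> sat D \<Phi>\<^sub>1 s \<or> sat D \<Phi>\<^sub>2 s"
  by (simp add: Or_def)

lemma sat_Top [simp]: "sat D (Top a) s"
  by (simp add: Top_def)

lemma equiv_Bot_iff: "equiv_Bot \<Phi> \<longleftrightarrow> property_of \<Phi> = {}"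
proof -
  have "property_of (Bot a) = {}" for a :: 'a
    by (auto simp: property_of_def mc_sat_def Bot_def)
  then show ?thesis by (simp add: equiv_Bot_def equivalent_def)
qed

lemma sat_literal_cong:
  assumes "literal \<Psi>" and "slab D s = slab D' s'"
  shows "sat D \<Psi> s \<longleftrightarrow> sat D' \<Psi> s'"
  using assms by induction auto

lemma satisfiable_if_not_equiv_Bot_Eventually:
  fixes \<Psi> :: "'ap state_formula"
  assumes "\<not> equiv_Bot (Prob GreaterEq q (Eventually a \<Psi>))" and "q > 0"
  obtains D :: "'ap mc" and s where "sat D \<Psi> s"
proof -
  obtain D :: "'ap mc" where "sat D (Prob GreaterEq q (Eventually a \<Psi>)) (init D)"
    using assms(1) by (auto simp: equiv_Bot_iff property_of_def mc_sat_def)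
  then have "measure (path_measure D (init D)) {\<omega>. path_sat D (Eventually a \<Psi>) \<omega>} \<noteq> 0"
    using \<open>q > 0\<close> by auto
  then have "{\<omega>. path_sat D (Eventually a \<Psi>) \<omega>} \<noteq> {}"
    by (metis measure_empty)
  then show ?thesis
    using that by (auto simp: Eventually_def)
qed

text \<open>As suffixes of paths are paths, every label is in fact visited infinitely often.\<close>

definition label_recurrent :: "'ap mc \<Rightarrow> bool" where
  "label_recurrent D \<longleftrightarrow> (\<forall>s. \<forall>\<omega>\<in>paths D s. \<forall>X. \<exists>i. slab D (\<omega> i) = X)"

lemma sat_Eventually_literal:
  fixes D :: "'ap mc"
  assumes "label_recurrent D" and "literal \<Psi>" and "0 \<le> q" "q \<le> 1"
    and "\<not> equiv_Bot (Prob GreaterEq q (Eventually a \<Psi>))"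
  shows "sat D (Prob GreaterEq q (Eventually a \<Psi>)) s"
proof (cases "q = 0")
  case False
  then have "q > 0" using \<open>0 \<le> q\<close> by simp
  then obtain E :: "'ap mc" and t where t: "sat E \<Psi> t"
    by (rule satisfiable_if_not_equiv_Bot_Eventually[OF assms(5)])
  show ?thesis
  proof (rule sat_Prob_GreaterEqI)
    fix \<omega> assume "\<omega> \<in> paths D s"
    then obtain i where "slab D (\<omega> i) = slab E t"
      using assms(1) unfolding label_recurrent_def by blast
    then have "sat D \<Psi> (\<omega> i)"
      using sat_literal_cong[OF \<open>literal \<Psi>\<close>] t by blast
    then show "path_sat D (Eventually a \<Psi>) \<omega>"
      by (auto simp: Eventually_def)
  qed fact
qed simp

lemma sat_pctl_live:
  assumes "label_recurrent D" and "\<Phi> \<in> pctl_live"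
  shows "sat D \<Phi> s"
  using assms(2)
proof (induction arbitrary: s)
  case (eventually \<Psi> q a)
  then show ?case by (intro sat_Eventually_literal assms(1))
next
  case (weak_until \<Phi>\<^sub>1 \<Phi>\<^sub>2 q)
  then show ?case
    by (intro sat_Prob_GreaterEqI) (auto intro: exI[of _ 0])
next
  case (next_step \<Phi> q)
  then show ?case
    by (intro sat_Prob_GreaterEqI) auto
next
  case (until \<Phi>\<^sub>1 \<Phi>\<^sub>2 q)
  then show ?case
    by (intro sat_Prob_GreaterEqI) (auto intro: exI[of _ 0])
qed auto

section \<open>Trees generated by a kernel\<close>

inductive_set tree_nodes :: "nat \<Rightarrow> (nat list \<Rightarrow> nat pmf) \<Rightarrow> nat list set" for r \<kappa> where
  root: "[r] \<in> tree_nodes r \<kappa>"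
| snoc: "\<pi> \<in> tree_nodes r \<kappa> \<Longrightarrow> n \<in> set_pmf (\<kappa> \<pi>) \<Longrightarrow> \<pi> @ [n] \<in> tree_nodes r \<kappa>"

definition tree_pt :: "nat \<Rightarrow> (nat list \<Rightarrow> nat pmf) \<Rightarrow> (nat list \<Rightarrow> 'ap set) \<Rightarrow> 'ap pt" where
  "tree_pt r \<kappa> l = \<lparr>nodes = tree_nodes r \<kappa>, lab = l,
     sdist = (\<lambda>\<pi>. if \<pi> \<in> tree_nodes r \<kappa> then Some (map_pmf (\<lambda>n. \<pi> @ [n]) (\<kappa> \<pi>)) else None)\<rparr>"

lemma tree_pt_simps [simp]:
  "nodes (tree_pt r \<kappa> l) = tree_nodes r \<kappa>"
  "lab (tree_pt r \<kappa> l) = l"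
  "sdist (tree_pt r \<kappa> l) \<pi> =
     (if \<pi> \<in> tree_nodes r \<kappa> then Some (map_pmf (\<lambda>n. \<pi> @ [n]) (\<kappa> \<pi>)) else None)"
  by (simp_all add: tree_pt_def)

lemma edge_prob_tree_pt:
  "\<pi> \<in> tree_nodes r \<kappa> \<Longrightarrow>
    edge_prob (tree_pt r \<kappa> l) \<pi> \<pi>' = pmf (map_pmf (\<lambda>n. \<pi> @ [n]) (\<kappa> \<pi>)) \<pi>'"
  by (simp add: edge_prob_def)

lemma Nil_notin_tree_nodes [simp]: "[] \<notin> tree_nodes r \<kappa>"
  by (auto elim: tree_nodes.cases)

lemma snoc_in_tree_nodes_iff:
  "\<pi> @ [n] \<in> tree_nodes r \<kappa> \<longleftrightarrow> \<pi> = [] \<and> n = r \<or> \<pi> \<in> tree_nodes r \<kappa> \<and> n \<in> set_pmf (\<kappa> \<pi>)"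
  by (auto elim: tree_nodes.cases intro: tree_nodes.intros)

lemma tree_nodes_prefix_closed:
  assumes "\<pi> \<in> tree_nodes r \<kappa>" and "prefix \<pi>' \<pi>"
  shows "\<pi>' \<in> tree_nodes r \<kappa> \<union> {[]}"
  using assms by (induction \<pi> rule: rev_induct) (auto simp: snoc_in_tree_nodes_iff tree_nodes.root)

lemma is_pt_tree_pt: "is_pt (tree_pt r \<kappa> l)"
proof -
  have "n = r" if "[n] \<in> tree_nodes r \<kappa>" for n
    using that snoc_in_tree_nodes_iff[of "[]"] by simp
  then have "\<forall>m n. [m] \<in> tree_nodes r \<kappa> \<longrightarrow> [n] \<in> tree_nodes r \<kappa> \<longrightarrow> m = n"
    by metis
  moreover have "edge_prob (tree_pt r \<kappa> l) \<pi> \<pi>' > 0 \<longleftrightarrow> (\<exists>n. \<pi>' = \<pi> @ [n]) \<and> \<pi>' \<in> tree_nodes r \<kappa>"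
    if "\<pi> \<in> tree_nodes r \<kappa>" for \<pi> \<pi>'
    using that by (auto simp: edge_prob_tree_pt pmf_positive_iff snoc_in_tree_nodes_iff)
  ultimately show ?thesis
    using tree_nodes_prefix_closed unfolding is_pt_def
    by (auto simp: subset_iff tree_nodes.snoc)
qed

lemma tree_pt_in_total_pts: "tree_pt r \<kappa> l \<in> total_pts"
proof -
  have "\<exists>\<pi>'\<in>tree_nodes r \<kappa>. strict_prefix \<pi> \<pi>'" if "\<pi> \<in> tree_nodes r \<kappa>" for \<pi>
  proof -
    obtain n where "n \<in> set_pmf (\<kappa> \<pi>)" using set_pmf_not_empty by fast
    with that show ?thesis by (intro bexI[of _ "\<pi> @ [n]"] tree_nodes.snoc) (auto simp: strict_prefix_def)
  qed
  then show ?thesis by (simp add: total_pts_def is_pt_tree_pt)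
qed

lemma total_pts_if_pt_iso:
  assumes "is_pt T" and "pt_iso T T'" and "T' \<in> total_pts"
  shows "T \<in> total_pts"
proof -
  obtain f where bij: "bij_betw f (nodes T) (nodes T')"
    and mono: "\<And>\<pi> \<pi>'. \<pi> \<in> nodes T \<Longrightarrow> \<pi>' \<in> nodes T \<Longrightarrow> prefix (f \<pi>) (f \<pi>') \<longleftrightarrow> prefix \<pi> \<pi>'"
    using assms(2) unfolding pt_iso_def by blast
  have "\<exists>\<pi>'\<in>nodes T. strict_prefix \<pi> \<pi>'" if \<pi>: "\<pi> \<in> nodes T" for \<pi>
  proof -
    have "f \<pi> \<in> nodes T'" using bij \<pi> by (rule bij_betw_apply)
    then obtain \<rho> where "\<rho> \<in> nodes T'" "strict_prefix (f \<pi>) \<rho>"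
      using assms(3) by (auto simp: total_pts_def)
    then obtain \<pi>' where "\<pi>' \<in> nodes T" "strict_prefix (f \<pi>) (f \<pi>')"
      using bij by (metis bij_betw_imp_surj_on imageE)
    with mono \<pi> show ?thesis by (auto simp: strict_prefix_def)
  qed
  with assms(1) show ?thesis by (simp add: total_pts_def)
qed

lemma unfolding_nodes_eq_tree_nodes:
  "unfolding_nodes D = tree_nodes (init D) (\<lambda>\<pi>. trn D (last \<pi>))"
proof (intro equalityI subsetI)
  fix \<pi> assume "\<pi> \<in> unfolding_nodes D"
  then show "\<pi> \<in> tree_nodes (init D) (\<lambda>\<pi>. trn D (last \<pi>))"
    by induction (auto intro: tree_nodes.intros simp: pmf_positive_iff)
next
  fix \<pi> assume "\<pi> \<in> tree_nodes (init D) (\<lambda>\<pi>. trn D (last \<pi>))"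
  then show "\<pi> \<in> unfolding_nodes D"
    by induction (auto intro: unfolding_nodes.intros simp: pmf_positive_iff)
qed

lemma unfolding_pt_eq_tree_pt:
  "unfolding_pt D = tree_pt (init D) (\<lambda>\<pi>. trn D (last \<pi>)) (\<lambda>\<pi>. slab D (last \<pi>))"
  by (simp add: unfolding_pt_def tree_pt_def unfolding_nodes_eq_tree_nodes)

lemma property_of_subset_total_pts: "property_of \<Phi> \<subseteq> total_pts"
proof
  fix T assume "T \<in> property_of \<Phi>"
  then obtain D where "is_pt T" "pt_iso T (unfolding_pt D)"
    unfolding property_of_def by blast
  then show "T \<in> total_pts"
    unfolding unfolding_pt_eq_tree_pt by (rule total_pts_if_pt_iso[OF _ _ tree_pt_in_total_pts])
qed

section \<open>Generated trees as unfoldings\<close>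

text \<open>
  The states are codes of lists. Since \<open>\<kappa>\<close> is defined on all lists, states that are not codes of
  tree nodes behave like the others.
\<close>

definition tree_mc :: "nat \<Rightarrow> (nat list \<Rightarrow> nat pmf) \<Rightarrow> (nat list \<Rightarrow> 'ap set) \<Rightarrow> 'ap mc" where
  "tree_mc r \<kappa> l = \<lparr>states = UNIV,
     trn = (\<lambda>s. map_pmf (\<lambda>n. to_nat (from_nat s @ [n])) (\<kappa> (from_nat s))),
     slab = (\<lambda>s. l (from_nat s)), init = to_nat [r]\<rparr>"

lemma tree_mc_simps [simp]:
  "trn (tree_mc r \<kappa> l) s = map_pmf (\<lambda>n. to_nat (from_nat s @ [n])) (\<kappa> (from_nat s))"
  "slab (tree_mc r \<kappa> l) s = l (from_nat s)"
  "init (tree_mc r \<kappa> l) = to_nat [r]"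
  by (simp_all add: tree_mc_def)

lemma is_mc_tree_mc: "is_mc (tree_mc r \<kappa> l)"
  by (simp add: is_mc_def tree_mc_def)

lemma length_along_path:
  assumes "\<omega> \<in> paths (tree_mc r \<kappa> l) s"
  shows "length (from_nat (\<omega> i) :: nat list) = length (from_nat s :: nat list) + i"
proof (induction i)
  case 0
  show ?case using assms by (simp add: paths_def)
next
  case (Suc i)
  have "\<omega> (Suc i) \<in> set_pmf (trn (tree_mc r \<kappa> l) (\<omega> i))"
    using assms by (simp add: paths_def)
  then have "\<exists>n::nat. \<omega> (Suc i) = to_nat (from_nat (\<omega> i) @ [n])"
    by auto
  with Suc.IH show ?case by auto
qed

lemma label_recurrent_tree_mc:
  assumes "\<And>X. \<exists>\<^sub>\<infinity>n. \<forall>\<pi>. length \<pi> = n \<longrightarrow> l \<pi> = X"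
  shows "label_recurrent (tree_mc r \<kappa> l)"
  unfolding label_recurrent_def
proof (intro allI ballI)
  fix s \<omega> X assume \<omega>: "\<omega> \<in> paths (tree_mc r \<kappa> l) s"
  let ?depth = "length (from_nat s :: nat list)"
  obtain n where "n \<ge> ?depth" and n: "\<And>\<pi>. length \<pi> = n \<Longrightarrow> l \<pi> = X"
    using assms[of X] unfolding INFM_nat_le by blast
  then have "length (from_nat (\<omega> (n - ?depth)) :: nat list) = n"
    by (simp add: length_along_path[OF \<omega>])
  then show "\<exists>i. slab (tree_mc r \<kappa> l) (\<omega> i) = X"
    using n by (auto intro!: exI[of _ "n - ?depth"])
qed

definition encode_prefixes :: "nat list \<Rightarrow> nat list" where
  "encode_prefixes \<pi> = map to_nat (tl (prefixes \<pi>))"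

lemma encode_prefixes_snoc [simp]:
  "encode_prefixes (\<pi> @ [n]) = encode_prefixes \<pi> @ [to_nat (\<pi> @ [n])]"
  by (simp add: encode_prefixes_def)

lemma encode_prefixes_singleton [simp]: "encode_prefixes [n] = [to_nat [n]]"
  by (simp add: encode_prefixes_def)

lemma last_encode_prefixes: "\<pi> \<noteq> [] \<Longrightarrow> last (encode_prefixes \<pi>) = to_nat \<pi>"
  by (cases \<pi> rule: rev_cases) auto

lemma prefix_encode_prefixes_iff:
  "prefix (encode_prefixes \<pi>) (encode_prefixes \<pi>') \<longleftrightarrow> prefix \<pi> \<pi>'"
proof
  assume pre: "prefix (encode_prefixes \<pi>) (encode_prefixes \<pi>')"
  show "prefix \<pi> \<pi>'"
  proof (cases \<pi> rule: rev_cases)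
    case (snoc \<rho> n)
    with pre have "to_nat \<pi> \<in> set (encode_prefixes \<pi>')"
      using set_mono_prefix by fastforce
    then have "\<pi> \<in> set (tl (prefixes \<pi>'))"
      by (auto simp: encode_prefixes_def)
    then show ?thesis
      by (meson in_set_prefixes list.set_sel(2) prefixes_not_Nil)
  qed simp
qed (auto simp: prefix_def encode_prefixes_def prefixes_append)

lemma inj_encode_prefixes: "inj encode_prefixes"
  by (metis injI prefix_encode_prefixes_iff prefix_order.order_antisym prefix_order.order_refl)

lemma unfolding_nodes_tree_mc:
  "unfolding_nodes (tree_mc r \<kappa> l) = encode_prefixes ` tree_nodes r \<kappa>"
proof (intro equalityI subsetI)
  fix \<rho> assume "\<rho> \<in> unfolding_nodes (tree_mc r \<kappa> l)"
  then show "\<rho> \<in> encode_prefixes ` tree_nodes r \<kappa>"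
  proof induction
    case root
    show ?case using tree_nodes.root by (intro image_eqI[of _ _ "[r]"]) auto
  next
    case (step \<rho> t)
    then obtain \<pi> where \<pi>: "\<pi> \<in> tree_nodes r \<kappa>" "\<rho> = encode_prefixes \<pi>" by blast
    then have "\<pi> \<noteq> []" by auto
    with step.hyps(2) \<pi>(2) obtain n where "n \<in> set_pmf (\<kappa> \<pi>)" "t = to_nat (\<pi> @ [n])"
      by (auto simp: last_encode_prefixes pmf_positive_iff)
    with \<pi> show ?case
      by (intro image_eqI[of _ _ "\<pi> @ [n]"] tree_nodes.snoc) auto
  qed
next
  have "encode_prefixes \<pi> \<in> unfolding_nodes (tree_mc r \<kappa> l)" if "\<pi> \<in> tree_nodes r \<kappa>" for \<pi>
    using that
  proof induction
    case root
    show ?case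
      using unfolding_nodes.root[of "tree_mc r \<kappa> l"] by simp
  next
    case (snoc \<pi> n)
    then have "\<pi> \<noteq> []" by auto
    with snoc show ?case
      by (auto simp: last_encode_prefixes pmf_positive_iff intro!: unfolding_nodes.step)
  qed
  then show "\<rho> \<in> unfolding_nodes (tree_mc r \<kappa> l)" if "\<rho> \<in> encode_prefixes ` tree_nodes r \<kappa>" for \<rho>
    using that by blast
qed

lemma edge_prob_unfolding_tree_mc:
  assumes "\<pi> \<in> tree_nodes r \<kappa>"
  shows "edge_prob (unfolding_pt (tree_mc r \<kappa> l)) (encode_prefixes \<pi>) (encode_prefixes \<pi>') =
    edge_prob (tree_pt r \<kappa> l) \<pi> \<pi>'"
proof -
  let ?\<rho> = "encode_prefixes \<pi>"
  have "\<pi> \<noteq> []" using assms by auto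
  with assms have "sdist (unfolding_pt (tree_mc r \<kappa> l)) ?\<rho> =
      Some (map_pmf encode_prefixes (map_pmf (\<lambda>n. \<pi> @ [n]) (\<kappa> \<pi>)))"
    by (simp add: unfolding_pt_def unfolding_nodes_tree_mc last_encode_prefixes map_pmf_comp)
  then have "edge_prob (unfolding_pt (tree_mc r \<kappa> l)) ?\<rho> (encode_prefixes \<pi>') =
      pmf (map_pmf encode_prefixes (map_pmf (\<lambda>n. \<pi> @ [n]) (\<kappa> \<pi>))) (encode_prefixes \<pi>')"
    by (simp only: edge_prob_def option.case)
  also have "\<dots> = edge_prob (tree_pt r \<kappa> l) \<pi> \<pi>'"
    using assms by (simp only: edge_prob_tree_pt pmf_map_inj' inj_encode_prefixes)
  finally show ?thesis .
qed

lemma pt_iso_unfolding_tree_mc: "pt_iso (tree_pt r \<kappa> l) (unfolding_pt (tree_mc r \<kappa> l))"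
  unfolding pt_iso_def
proof (intro exI[of _ encode_prefixes] conjI ballI)
  show "bij_betw encode_prefixes (nodes (tree_pt r \<kappa> l)) (nodes (unfolding_pt (tree_mc r \<kappa> l)))"
    by (simp add: unfolding_pt_def unfolding_nodes_tree_mc
        inj_on_imp_bij_betw inj_on_subset[OF inj_encode_prefixes])
  fix \<pi> assume "\<pi> \<in> nodes (tree_pt r \<kappa> l)"
  then have \<pi>: "\<pi> \<in> tree_nodes r \<kappa>" by simp
  then have "\<pi> \<noteq> []" by auto
  then show "lab (unfolding_pt (tree_mc r \<kappa> l)) (encode_prefixes \<pi>) = lab (tree_pt r \<kappa> l) \<pi>"
    by (simp add: unfolding_pt_def last_encode_prefixes)
  show "edge_prob (unfolding_pt (tree_mc r \<kappa> l)) (encode_prefixes \<pi>) (encode_prefixes \<pi>') =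
      edge_prob (tree_pt r \<kappa> l) \<pi> \<pi>'" for \<pi>'
    using \<pi> by (rule edge_prob_unfolding_tree_mc)
qed (rule prefix_encode_prefixes_iff)

section \<open>Extending a finite-depth tree\<close>

definition extend_kernel :: "'ap pt \<Rightarrow> nat list \<Rightarrow> nat pmf" where
  "extend_kernel T \<pi> = (case sdist T \<pi> of None \<Rightarrow> return_pmf 0 | Some \<mu> \<Rightarrow> map_pmf last \<mu>)"

definition extend_lab :: "'ap pt \<Rightarrow> (nat \<Rightarrow> 'ap set) \<Rightarrow> nat list \<Rightarrow> 'ap set" where
  "extend_lab T g \<pi> = (if \<pi> \<in> nodes T then lab T \<pi> else g (length \<pi>))"

lemma is_pt_edge_prob_pos:
  "is_pt T \<Longrightarrow> \<pi> \<in> nodes T \<Longrightarrow> \<pi> @ [n] \<in> nodes T \<Longrightarrow> edge_prob T \<pi> (\<pi> @ [n]) > 0"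
  unfolding is_pt_def by blast

lemma is_pt_butlast_in_nodes:
  assumes "is_pt T" and "\<pi> @ [n] \<in> nodes T" and "\<pi> \<noteq> []"
  shows "\<pi> \<in> nodes T"
proof -
  have "\<pi> \<in> nodes T \<union> {[]}"
    using assms(1,2) unfolding is_pt_def by (meson prefixI)
  with \<open>\<pi> \<noteq> []\<close> show ?thesis by simp
qed

lemma is_pt_sdistE:
  assumes "is_pt T" and "sdist T \<pi> = Some \<mu>" and "\<pi>' \<in> set_pmf \<mu>"
  obtains n where "\<pi>' = \<pi> @ [n]"
proof -
  have "\<pi> \<in> nodes T"
    using assms(1,2) unfolding is_pt_def by (metis option.distinct(1))
  moreover have "edge_prob T \<pi> \<pi>' > 0"
    using assms by (simp add: edge_prob_def pmf_positive_iff)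
  ultimately show ?thesis
    using assms(1) that by (auto simp: is_pt_def)
qed

lemma map_snoc_extend_kernel:
  assumes "is_pt T" and "sdist T \<pi> = Some \<mu>"
  shows "map_pmf (\<lambda>n. \<pi> @ [n]) (extend_kernel T \<pi>) = \<mu>"
proof -
  have "map_pmf (\<lambda>n. \<pi> @ [n]) (extend_kernel T \<pi>) = map_pmf (\<lambda>\<pi>'. \<pi> @ [last \<pi>']) \<mu>"
    using assms(2) by (simp add: extend_kernel_def map_pmf_comp)
  also have "\<dots> = map_pmf (\<lambda>\<pi>'. \<pi>') \<mu>"
    by (rule map_pmf_cong) (auto elim: is_pt_sdistE[OF assms])
  finally show ?thesis by simp
qed

lemma pmf_extend_kernel:
  assumes "is_pt T" and "\<pi> \<in> nodes T" and "\<pi>' \<in> nodes T"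
  shows "pmf (map_pmf (\<lambda>n. \<pi> @ [n]) (extend_kernel T \<pi>)) \<pi>' = edge_prob T \<pi> \<pi>'"
proof (cases "sdist T \<pi>")
  case None
  then have "\<pi>' \<noteq> \<pi> @ [0]"
    using is_pt_edge_prob_pos[OF assms(1,2)] assms(3) by (auto simp: edge_prob_def)
  with None show ?thesis by (simp add: extend_kernel_def edge_prob_def)
next
  case (Some \<mu>)
  then show ?thesis using assms(1) by (simp add: map_snoc_extend_kernel edge_prob_def)
qed

lemma nodes_subset_tree_nodes:
  assumes T: "is_pt T" and root: "\<And>n. [n] \<in> nodes T \<Longrightarrow> n = r"
  shows "nodes T \<subseteq> tree_nodes r (extend_kernel T)"
proof
  fix \<pi> assume "\<pi> \<in> nodes T"
  then show "\<pi> \<in> tree_nodes r (extend_kernel T)"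
  proof (induction \<pi> rule: rev_induct)
    case Nil
    then show ?case using T by (simp add: is_pt_def)
  next
    case (snoc n \<pi>)
    show ?case
    proof (cases "\<pi> = []")
      case True
      then show ?thesis using snoc.prems root tree_nodes.root by auto
    next
      case False
      then have \<pi>: "\<pi> \<in> nodes T"
        using is_pt_butlast_in_nodes T snoc.prems by blast
      then have "pmf (map_pmf (\<lambda>n. \<pi> @ [n]) (extend_kernel T \<pi>)) (\<pi> @ [n]) > 0"
        using pmf_extend_kernel is_pt_edge_prob_pos T snoc.prems by metis
      then have "n \<in> set_pmf (extend_kernel T \<pi>)"
        by (auto simp: pmf_positive_iff)
      with snoc.IH[OF \<pi>] show ?thesis by (rule tree_nodes.snoc)
    qed
  qed
qed

lemma pt_prefix_extension:
  assumes "is_pt T" and "\<And>n. [n] \<in> nodes T \<Longrightarrow> n = r"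
  shows "pt_prefix T (tree_pt r (extend_kernel T) (extend_lab T g))"
  using nodes_subset_tree_nodes[OF assms] pmf_extend_kernel[OF assms(1)]
  by (auto simp: pt_prefix_def extend_lab_def edge_prob_tree_pt subset_iff)

lemma ex_recurrent_enumeration: "\<exists>g :: nat \<Rightarrow> 'a::countable. \<forall>x. \<exists>\<^sub>\<infinity>n. g n = x"
proof (intro exI allI)
  fix x :: 'a
  have "from_nat (fst (prod_decode (prod_encode (to_nat x, m)))) = x" for m
    by simp
  then show "\<exists>\<^sub>\<infinity>n. from_nat (fst (prod_decode n)) = x"
    unfolding INFM_nat_le using le_prod_encode_2 by blast
qed

lemma finite_depth_pt_extends_to_label_recurrent:
  fixes T :: "'ap::finite pt"
  assumes "T \<in> finite_depth_pts"
  obtains T' D where "is_pt T'" "pt_prefix T T'"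
    and "is_mc D" "label_recurrent D" "pt_iso T' (unfolding_pt D)"
proof -
  obtain k where T: "is_pt T" and k: "\<And>\<pi>. \<pi> \<in> nodes T \<Longrightarrow> length \<pi> \<le> k"
    using assms by (auto simp: finite_depth_pts_def)
  obtain r where r: "\<And>n. [n] \<in> nodes T \<Longrightarrow> n = r"
    using T unfolding is_pt_def by metis
  obtain g :: "nat \<Rightarrow> 'ap set" where g: "\<And>X. \<exists>\<^sub>\<infinity>n. g n = X"
    using ex_recurrent_enumeration by metis
  have "\<exists>\<^sub>\<infinity>n. \<forall>\<pi>. length \<pi> = n \<longrightarrow> extend_lab T g \<pi> = X" for X
  proof -
    have "\<exists>\<^sub>\<infinity>n. g n = X \<and> n > k"
      using g MOST_nat by (intro INFM_conjI) auto
    then show ?thesis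
      by (rule INFM_mono) (auto simp: extend_lab_def dest: k)
  qed
  then have "label_recurrent (tree_mc r (extend_kernel T) (extend_lab T g))"
    by (rule label_recurrent_tree_mc)
  then show ?thesis
    using that[OF is_pt_tree_pt pt_prefix_extension[OF T r] is_mc_tree_mc _ pt_iso_unfolding_tree_mc]
    by blast
qed

theorem theorem6:
  fixes \<Phi> :: "'ap::finite state_formula"
  assumes "\<Phi> \<in> pctl_live"
  shows "liveness (property_of \<Phi>)"
  unfolding liveness_def
proof (intro conjI ballI)
  show "property_of \<Phi> \<subseteq> total_pts" by (rule property_of_subset_total_pts)
  fix T :: "'ap pt" assume "T \<in> finite_depth_pts"
  then obtain T' D where "is_pt T'" "pt_prefix T T'"
    and D: "is_mc D" "label_recurrent D" "pt_iso T' (unfolding_pt D)"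
    by (rule finite_depth_pt_extends_to_label_recurrent)
  have "mc_sat D \<Phi>"
    unfolding mc_sat_def using \<open>label_recurrent D\<close> assms by (rule sat_pctl_live)
  with \<open>is_pt T'\<close> D have "T' \<in> property_of \<Phi>"
    by (auto simp: property_of_def)
  with \<open>pt_prefix T T'\<close> show "\<exists>T\<^sub>2\<in>property_of \<Phi>. pt_prefix T T\<^sub>2" by blast
qed

end
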